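(* Let $(T,\cdot,e)$ be a monoid with a fixed generating set $G$, let $M$ be a $G$-uniform $T$-graded monad on $\mathbf{Set}$, and let $\mathcal{L}=(\Theta,\mathcal{O},\Lambda)$ be a trace logic for $M$ which is unit separating and inductively separating. Then the uniform-depth fragment of $\mathcal{L}$ is expressive with respect to trace equivalence: if states $x\in X$ and $y\in Y$ of graded $M$-coalgebras $(X,\gamma)$ and $(Y,\delta)$ satisfy $[\![\phi]\!]_\gamma(x)=[\![\phi]\!]_\delta(y)$ for every $k\in T$ and every formula $\phi\in\mathcal{F}_k(\mathcal{L})$ of uniform depth $k$, then $x$ and $y$ are trace equivalent.
   Context: A $T$-graded monad $M$ on $\mathbf{Set}$, for a monoid $(T,\cdot,e)$, consists of endofunctors $M_t$ ($t\in T$) and natural transformations $\mu^{s,t}\colon M_sM_t\to M_{s\cdot t}$, $\eta\colon\mathrm{Id}\to M_e$ such that $\mu^{r,s\cdot t}\circ M_r\mu^{s,t}=\mu^{r\cdot s,t}\circ\mu^{r,s}M_t$ and $\mu^{t,e}\circ M_t\eta=\mathrm{id}=\mu^{e,t}\circ\eta M_t$; in particular $(M_e,\mu^{e,e},\eta)$ is a monad and $(M_tX,\mu^{e,t}_X)$ is an $M_e$-algebra. A graded $M$-coalgebra is a set $X$ with maps $\gamma_t\colon X\to M_tX$ such that $\gamma_e=\eta_X$ and $\gamma_{s\cdot t}=\mu^{s,t}_X\circ M_s\gamma_t\circ\gamma_s$. States $x\in X$, $y\in Y$ of $(X,\gamma)$, $(Y,\delta)$ are trace equivalent if $M_t(!_X)(\gamma_t(x))=M_t(!_Y)(\delta_t(y))$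 for all $t\in T$, where $!_X\colon X\to1$ and $!_Y\colon Y\to1$. $M$ is $G$-uniform if for all $g\in G$, $t\in T$ the map $\mu^{g,t}\colon M_gM_t\to M_{g\cdot t}$ is (at each set $X$) a coequalizer of $M_g\mu^{e,t},\ \mu^{g,e}M_t\colon M_gM_eM_t\to M_gM_t$ in the Eilenberg-Moore category of $(M_e,\mu^{e,e},\eta)$. A graded coalgebraic modal logic $\mathcal{L}=(\Theta,\mathcal{O},\Lambda)$ consists of a set $\Theta$ of constants, a set $\mathcal{O}$ of propositional operators $p$ with finite arities $\mathrm{ar}(p)\in\mathbb{N}$, and a set $\Lambda$ of (unary) modal operators $\lambda$ with depths $\mathsf{d}(\lambda)\in G$. The semantics is given by a set $\Omega$, elements $\hat\theta\colon1\to\Omega$, maps $[\![p]\!]\colon\Omega^{\mathrm{ar}(p)}\to\Omega$ and maps $[\![\lambda]\!]\colon M_{\mathsf{d}(\lambda)}\Omega\to\Omega$. For a graded coalgebra $(X,\gamma)$, $[\![\phi]\!]_\gamma\colon X\to\Omega$ is defined by: $[\![\theta]\!]_\gamma$ is constant with value $\hat\theta$; $[\![p(\phi_1,\dots,\phi_n)]\!]_\gamma=[\![p]\!]\circ\langle[\![\phi_1]\!]_\gamma,\dots,[\![\phi_n]\!]_\gamma\rangle$; $[\![\lambda\phi]\!]_\gamma=[\![\lambda]\!]\circ M_{\mathsf{d}(\lambda)}[\![\phi]\!]_\gamma\circ\gamma_{\mathsf{d}(\lambda)}$. $\mathcal{L}$ is a trace logic if (i) $\Omega$ carries an $M_e$-algebra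 structure $o\colon M_e\Omega\to\Omega$; (ii) each $[\![p]\!]\colon(\Omega,o)^n\to(\Omega,o)$ is an $M_e$-algebra homomorphism; (iii) for each $\lambda\in\Lambda$ of depth $t$: $[\![\lambda]\!]\circ\mu^{t,e}_\Omega=[\![\lambda]\!]\circ M_to$ and $[\![\lambda]\!]\circ\mu^{e,t}_\Omega=o\circ M_e[\![\lambda]\!]$. The sets $\mathcal{F}_k(\mathcal{L})$ ($k\in T$) of formulae of uniform depth $k$ are defined inductively: $\theta\in\mathcal{F}_e(\mathcal{L})$ for $\theta\in\Theta$; $p(\phi_1,\dots,\phi_n)\in\mathcal{F}_k(\mathcal{L})$ if $p\in\mathcal{O}$, $n=\mathrm{ar}(p)$ and all $\phi_i\in\mathcal{F}_k(\mathcal{L})$; $\lambda\phi\in\mathcal{F}_k(\mathcal{L})$ if $\phi\in\mathcal{F}_l(\mathcal{L})$ with $\mathsf{d}(\lambda)\cdot l=k$. The uniform-depth fragment is $\bigcup_{k\in T}\mathcal{F}_k(\mathcal{L})$. For $\lambda\in\Lambda$ with $\mathsf{d}(\lambda)=g$ and an $M_e$-algebra homomorphism $h\colon(M_t1,\mu^{e,t})\to(\Omega,o)$, let $(\!|\lambda h|\!)\colon M_{g\cdot t}1\to\Omega$ be the unique $M_e$-algebra homomorphism with $(\!|\lambda h|\!)\circ\mu^{g,t}_1=[\![\lambda]\!]\circ M_gh$ (it exists by $G$-uniformity and (iii)). For $\theta\in\Theta$ put $(\!|\theta|\!)=o\circ M_e\hat\theta\colon M_e1\to\Omega$, and for $p\in\mathcal{O}$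 with $\mathrm{ar}(p)=0$ let $(\!|p|\!)\colon M_e1\to\Omega$ be the constant map with value $[\![p]\!]$. $\mathcal{L}$ is unit separating if the set $\{(\!|\theta|\!),(\!|p|\!)\colon M_e1\to\Omega\mid\theta\in\Theta,\ p\in\mathcal{O},\ \mathrm{ar}(p)=0\}$ is jointly injective. $\mathcal{L}$ is inductively separating if for all $g\in G$, $t\in T$ and every jointly injective set $\mathfrak{A}$ of $M_e$-algebra homomorphisms $(M_t1,\mu^{e,t})\to(\Omega,o)$ that is closed under $\mathcal{O}$ (i.e. $[\![p]\!]\circ\langle h_1,\dots,h_n\rangle\in\mathfrak{A}$ for $p\in\mathcal{O}$ of arity $n$ and $h_i\in\mathfrak{A}$), the set $\{(\!|\lambda h|\!)\colon M_{g\cdot t}1\to\Omega\mid\lambda\in\Lambda,\ \mathsf{d}(\lambda)=g,\ h\in\mathfrak{A}\}$ is jointly injective. *)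

theory Defs
  imports "HOL-Library.FuncSet"
begin

text \<open>
  HOL cannot quantify over endofunctors of the category of all sets (type constructors), so Set is
  the category whose objects are the members of a universe of sets \<open>objs\<close> over an arbitrary type,
  and whose morphisms \<open>A \<rightarrow> B\<close> are all functions, i.e. the elements of
  \<open>A \<rightarrow>\<^sub>E B\<close>. These functions are extensional (\<open>undefined\<close> off \<open>A\<close>), so that HOL equality is equality
  of morphisms; \<open>compose A g f\<close> is the composite of \<open>f : A \<rightarrow> B\<close> and \<open>g : B \<rightarrow> C\<close>.
  The type and the universe are kept arbitrary, and the only closure conditions asked of the
  universe are those of \<open>set_universe\<close>; in particular the members of a Grothendieck universe qualify.
  Finite tuples of elements are coded as elements by the injection \<open>tup\<close>; this provides the finite
  powers in Set, and the terminal object as the set consisting of the empty tuple.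
\<close>

record 'u universe =
  objs :: "'u set set"
  tup :: "'u list \<Rightarrow> 'u"

definition power_set :: "('u, 'z) universe_scheme \<Rightarrow> 'u set \<Rightarrow> nat \<Rightarrow> 'u set" where
  "power_set U A n = tup U ` {xs. length xs = n \<and> set xs \<subseteq> A}"

definition proj :: "('u, 'z) universe_scheme \<Rightarrow> 'u set \<Rightarrow> nat \<Rightarrow> nat \<Rightarrow> 'u \<Rightarrow> 'u" where
  "proj U A n i = (\<lambda>w\<in>power_set U A n. inv (tup U) w ! i)"

definition set_universe :: "('u, 'z) universe_scheme \<Rightarrow> bool" where
  "set_universe U \<longleftrightarrow>
     inj (tup U) \<and> objs U \<noteq> {} \<and>
     (\<forall>A\<in>objs U. \<forall>B\<subseteq>A. B \<in> objs U) \<and>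
     (\<forall>A\<in>objs U. \<forall>f. f ` A \<in> objs U) \<and>
     (\<forall>A\<in>objs U. \<forall>n. power_set U A n \<in> objs U)"

definition terminal :: "('u, 'z) universe_scheme \<Rightarrow> 'u set" where
  "terminal U = {tup U []}"

definition bang :: "('u, 'z) universe_scheme \<Rightarrow> 'u set \<Rightarrow> 'u \<Rightarrow> 'u" where
  "bang U X = (\<lambda>x\<in>X. tup U [])"

text \<open>
  \<open>Mob M t A\<close> is $M_t A$; \<open>Mmap M t A B f\<close> is $M_t f$ for \<open>f : A \<rightarrow> B\<close>; \<open>mu M s t A\<close> is the component
  at \<open>A\<close> of $\mu^{s,t}$. The grading monoid is the type \<open>'t\<close> of class \<^class>\<open>monoid_mult\<close>, with unit 1.
\<close>

record ('t, 'u) gmonad =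
  Mob :: "'t \<Rightarrow> 'u set \<Rightarrow> 'u set"
  Mmap :: "'t \<Rightarrow> 'u set \<Rightarrow> 'u set \<Rightarrow> ('u \<Rightarrow> 'u) \<Rightarrow> 'u \<Rightarrow> 'u"
  mu :: "'t \<Rightarrow> 't \<Rightarrow> 'u set \<Rightarrow> 'u \<Rightarrow> 'u"
  eta :: "'u set \<Rightarrow> 'u \<Rightarrow> 'u"

definition set_endofunctor ::
  "('u, 'z) universe_scheme \<Rightarrow> ('u set \<Rightarrow> 'u set) \<Rightarrow> ('u set \<Rightarrow> 'u set \<Rightarrow> ('u \<Rightarrow> 'u) \<Rightarrow> 'u \<Rightarrow> 'u) \<Rightarrow> bool"
  where
  "set_endofunctor U F Fm \<longleftrightarrow>
     (\<forall>A\<in>objs U. F A \<in> objs U) \<and>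
     (\<forall>A\<in>objs U. \<forall>B\<in>objs U. \<forall>f\<in>A \<rightarrow>\<^sub>E B. Fm A B f \<in> F A \<rightarrow>\<^sub>E F B) \<and>
     (\<forall>A\<in>objs U. Fm A A (\<lambda>x\<in>A. x) = (\<lambda>z\<in>F A. z)) \<and>
     (\<forall>A\<in>objs U. \<forall>B\<in>objs U. \<forall>C\<in>objs U. \<forall>f\<in>A \<rightarrow>\<^sub>E B. \<forall>g\<in>B \<rightarrow>\<^sub>E C.
        Fm A C (compose A g f) = compose (F A) (Fm B C g) (Fm A B f))"

definition graded_monad :: "('u, 'z) universe_scheme \<Rightarrow> ('t::monoid_mult, 'u) gmonad \<Rightarrow> bool" where
  "graded_monad U M \<longleftrightarrow>
     (\<forall>t. set_endofunctor U (Mob M t) (Mmap M t)) \<and>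
     (\<forall>s t. \<forall>A\<in>objs U. mu M s t A \<in> Mob M s (Mob M t A) \<rightarrow>\<^sub>E Mob M (s * t) A) \<and>
     (\<forall>s t. \<forall>A\<in>objs U. \<forall>B\<in>objs U. \<forall>f\<in>A \<rightarrow>\<^sub>E B.
        compose (Mob M s (Mob M t A)) (mu M s t B) (Mmap M s (Mob M t A) (Mob M t B) (Mmap M t A B f))
        = compose (Mob M s (Mob M t A)) (Mmap M (s * t) A B f) (mu M s t A)) \<and>
     (\<forall>A\<in>objs U. eta M A \<in> A \<rightarrow>\<^sub>E Mob M 1 A) \<and>
     (\<forall>A\<in>objs U. \<forall>B\<in>objs U. \<forall>f\<in>A \<rightarrow>\<^sub>E B.
        compose A (eta M B) f = compose A (Mmap M 1 A B f) (eta M A)) \<and>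
     (\<forall>r s t. \<forall>A\<in>objs U.
        compose (Mob M r (Mob M s (Mob M t A)))
          (mu M r (s * t) A) (Mmap M r (Mob M s (Mob M t A)) (Mob M (s * t) A) (mu M s t A))
        = compose (Mob M r (Mob M s (Mob M t A))) (mu M (r * s) t A) (mu M r s (Mob M t A))) \<and>
     (\<forall>t. \<forall>A\<in>objs U.
        compose (Mob M t A) (mu M t 1 A) (Mmap M t A (Mob M 1 A) (eta M A)) = (\<lambda>z\<in>Mob M t A. z) \<and>
        compose (Mob M t A) (mu M 1 t A) (eta M (Mob M t A)) = (\<lambda>z\<in>Mob M t A. z))"

definition generating_set :: "'t::monoid_mult set \<Rightarrow> bool" where
  "generating_set G \<longleftrightarrow> (\<forall>t. \<exists>gs. set gs \<subseteq> G \<and> t = prod_list gs)"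

type_synonym 'u alg = "'u set \<times> ('u \<Rightarrow> 'u)"

fun em_algebra :: "('u, 'z) universe_scheme \<Rightarrow> ('t::monoid_mult, 'u) gmonad \<Rightarrow> 'u alg \<Rightarrow> bool" where
  "em_algebra U M (A, a) \<longleftrightarrow>
     A \<in> objs U \<and> a \<in> Mob M 1 A \<rightarrow>\<^sub>E A \<and>
     compose A a (eta M A) = (\<lambda>x\<in>A. x) \<and>
     compose (Mob M 1 (Mob M 1 A)) a (mu M 1 1 A)
       = compose (Mob M 1 (Mob M 1 A)) a (Mmap M 1 (Mob M 1 A) A a)"

fun em_hom :: "('u, 'z) universe_scheme \<Rightarrow> ('t::monoid_mult, 'u) gmonad \<Rightarrow> 'u alg \<Rightarrow> 'u alg \<Rightarrow>
    ('u \<Rightarrow> 'u) \<Rightarrow> bool" where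
  "em_hom U M (A, a) (B, b) f \<longleftrightarrow>
     em_algebra U M (A, a) \<and> em_algebra U M (B, b) \<and> f \<in> A \<rightarrow>\<^sub>E B \<and>
     compose (Mob M 1 A) f a = compose (Mob M 1 A) b (Mmap M 1 A B f)"

definition em_coequalizer :: "('u, 'z) universe_scheme \<Rightarrow> ('t::monoid_mult, 'u) gmonad \<Rightarrow>
    'u alg \<Rightarrow> 'u alg \<Rightarrow> ('u \<Rightarrow> 'u) \<Rightarrow> ('u \<Rightarrow> 'u) \<Rightarrow> 'u alg \<Rightarrow> ('u \<Rightarrow> 'u) \<Rightarrow> bool" where
  "em_coequalizer U M A B f g C q \<longleftrightarrow>
     em_hom U M A B f \<and> em_hom U M A B g \<and> em_hom U M B C q \<and>
     compose (fst A) q f = compose (fst A) q g \<and>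
     (\<forall>D k. em_hom U M B D k \<and> compose (fst A) k f = compose (fst A) k g \<longrightarrow>
        (\<exists>!u. em_hom U M C D u \<and> compose (fst B) u q = k))"

definition Malg :: "('t::monoid_mult, 'u) gmonad \<Rightarrow> 't \<Rightarrow> 'u set \<Rightarrow> 'u alg" where
  "Malg M t A = (Mob M t A, mu M 1 t A)"

definition uniform_gmonad ::
  "('u, 'z) universe_scheme \<Rightarrow> ('t::monoid_mult, 'u) gmonad \<Rightarrow> 't set \<Rightarrow> bool" where
  "uniform_gmonad U M G \<longleftrightarrow>
     (\<forall>g\<in>G. \<forall>t. \<forall>A\<in>objs U.
        em_coequalizer U M
          (Malg M g (Mob M 1 (Mob M t A))) (Malg M g (Mob M t A))
          (Mmap M g (Mob M 1 (Mob M t A)) (Mob M t A) (mu M 1 t A))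
          (mu M g 1 (Mob M t A))
          (Malg M (g * t) A) (mu M g t A))"

text \<open>The product algebra $(A,a)^n$, with structure $\langle a \circ M_e \pi_i\rangle_{i<n}$.\<close>

fun power_alg :: "('u, 'z) universe_scheme \<Rightarrow> ('t::monoid_mult, 'u) gmonad \<Rightarrow> 'u alg \<Rightarrow> nat \<Rightarrow> 'u alg"
  where
  "power_alg U M (A, a) n =
     (power_set U A n,
      (\<lambda>z\<in>Mob M 1 (power_set U A n).
         tup U (map (\<lambda>i. a (Mmap M 1 (power_set U A n) A (proj U A n i) z)) [0..<n])))"

definition graded_coalgebra :: "('u, 'z) universe_scheme \<Rightarrow> ('t::monoid_mult, 'u) gmonad \<Rightarrow> 'u set \<Rightarrow>
    ('t \<Rightarrow> 'u \<Rightarrow> 'u) \<Rightarrow> bool" where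
  "graded_coalgebra U M X \<gamma> \<longleftrightarrow>
     X \<in> objs U \<and> (\<forall>t. \<gamma> t \<in> X \<rightarrow>\<^sub>E Mob M t X) \<and> \<gamma> 1 = eta M X \<and>
     (\<forall>s t. \<gamma> (s * t) = compose X (mu M s t X) (compose X (Mmap M s X (Mob M t X) (\<gamma> t)) (\<gamma> s)))"

definition trace_equivalent :: "('u, 'z) universe_scheme \<Rightarrow> ('t::monoid_mult, 'u) gmonad \<Rightarrow>
    'u set \<Rightarrow> ('t \<Rightarrow> 'u \<Rightarrow> 'u) \<Rightarrow> 'u \<Rightarrow> 'u set \<Rightarrow> ('t \<Rightarrow> 'u \<Rightarrow> 'u) \<Rightarrow> 'u \<Rightarrow> bool" where
  "trace_equivalent U M X \<gamma> x Y \<delta> y \<longleftrightarrow>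
     (\<forall>t. Mmap M t X (terminal U) (bang U X) (\<gamma> t x) = Mmap M t Y (terminal U) (bang U Y) (\<delta> t y))"

datatype ('c, 'p, 'l) formula =
    Const 'c
  | Op 'p "('c, 'p, 'l) formula list"
  | Modal 'l "('c, 'p, 'l) formula"

text \<open>
  Syntax $(\Theta,\mathcal{O},\Lambda)$ with arities and depths, together with the semantics. The symbols
  are given by sets rather than types because each of them may be empty.
\<close>

record ('c, 'p, 'l, 't, 'u) logic =
  consts_of :: "'c set"
  ops_of :: "'p set"
  mods_of :: "'l set"
  arity :: "'p \<Rightarrow> nat"
  depth :: "'l \<Rightarrow> 't"
  Omega :: "'u set"
  const_sem :: "'c \<Rightarrow> 'u"
  op_sem :: "'p \<Rightarrow> 'u \<Rightarrow> 'u"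
  mod_sem :: "'l \<Rightarrow> 'u \<Rightarrow> 'u"

definition graded_logic :: "('u, 'z) universe_scheme \<Rightarrow> ('t::monoid_mult, 'u) gmonad \<Rightarrow> 't set \<Rightarrow>
    ('c, 'p, 'l, 't, 'u) logic \<Rightarrow> bool" where
  "graded_logic U M G L \<longleftrightarrow>
     Omega L \<in> objs U \<and>
     (\<forall>c\<in>consts_of L. const_sem L c \<in> Omega L) \<and>
     (\<forall>p\<in>ops_of L. op_sem L p \<in> power_set U (Omega L) (arity L p) \<rightarrow>\<^sub>E Omega L) \<and>
     (\<forall>l\<in>mods_of L. depth L l \<in> G \<and> mod_sem L l \<in> Mob M (depth L l) (Omega L) \<rightarrow>\<^sub>E Omega L)"

fun sem :: "('u, 'z) universe_scheme \<Rightarrow> ('t::monoid_mult, 'u) gmonad \<Rightarrow> ('c, 'p, 'l, 't, 'u) logic \<Rightarrow>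
    'u set \<Rightarrow> ('t \<Rightarrow> 'u \<Rightarrow> 'u) \<Rightarrow> ('c, 'p, 'l) formula \<Rightarrow> 'u \<Rightarrow> 'u" where
  "sem U M L X \<gamma> (Const c) = (\<lambda>x\<in>X. const_sem L c)"
| "sem U M L X \<gamma> (Op p \<phi>s) = (\<lambda>x\<in>X. op_sem L p (tup U (map (\<lambda>\<phi>. sem U M L X \<gamma> \<phi> x) \<phi>s)))"
| "sem U M L X \<gamma> (Modal l \<phi>) =
     compose X (mod_sem L l)
       (compose X (Mmap M (depth L l) X (Omega L) (sem U M L X \<gamma> \<phi>)) (\<gamma> (depth L l)))"

inductive uniform_depth ::
  "('c, 'p, 'l, 't::monoid_mult, 'u) logic \<Rightarrow> 't \<Rightarrow> ('c, 'p, 'l) formula \<Rightarrow> bool" for L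
  where
  const: "c \<in> consts_of L \<Longrightarrow> uniform_depth L 1 (Const c)"
| op: "p \<in> ops_of L \<Longrightarrow> length \<phi>s = arity L p \<Longrightarrow> (\<forall>\<phi>\<in>set \<phi>s. uniform_depth L k \<phi>) \<Longrightarrow>
    uniform_depth L k (Op p \<phi>s)"
| modal: "l \<in> mods_of L \<Longrightarrow> uniform_depth L m \<phi> \<Longrightarrow> depth L l * m = k \<Longrightarrow>
    uniform_depth L k (Modal l \<phi>)"

definition uniform_formulas ::
  "('c, 'p, 'l, 't::monoid_mult, 'u) logic \<Rightarrow> 't \<Rightarrow> ('c, 'p, 'l) formula set" where
  "uniform_formulas L k = {\<phi>. uniform_depth L k \<phi>}"

definition trace_logic :: "('u, 'z) universe_scheme \<Rightarrow> ('t::monoid_mult, 'u) gmonad \<Rightarrow>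
    ('c, 'p, 'l, 't, 'u) logic \<Rightarrow> ('u \<Rightarrow> 'u) \<Rightarrow> bool" where
  "trace_logic U M L \<omega> \<longleftrightarrow>
     em_algebra U M (Omega L, \<omega>) \<and>
     (\<forall>p\<in>ops_of L. em_hom U M (power_alg U M (Omega L, \<omega>) (arity L p)) (Omega L, \<omega>) (op_sem L p)) \<and>
     (\<forall>l\<in>mods_of L. let t = depth L l; W = Omega L in
        compose (Mob M t (Mob M 1 W)) (mod_sem L l) (mu M t 1 W)
          = compose (Mob M t (Mob M 1 W)) (mod_sem L l) (Mmap M t (Mob M 1 W) W \<omega>) \<and>
        compose (Mob M 1 (Mob M t W)) (mod_sem L l) (mu M 1 t W)
          = compose (Mob M 1 (Mob M t W)) \<omega> (Mmap M 1 (Mob M t W) W (mod_sem L l)))"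

definition jointly_injective :: "'u set \<Rightarrow> ('u \<Rightarrow> 'v) set \<Rightarrow> bool" where
  "jointly_injective A \<FF> \<longleftrightarrow> (\<forall>x\<in>A. \<forall>y\<in>A. (\<forall>f\<in>\<FF>. f x = f y) \<longrightarrow> x = y)"

definition const_lift :: "('u, 'z) universe_scheme \<Rightarrow> ('t::monoid_mult, 'u) gmonad \<Rightarrow>
    ('c, 'p, 'l, 't, 'u) logic \<Rightarrow> ('u \<Rightarrow> 'u) \<Rightarrow> 'c \<Rightarrow> 'u \<Rightarrow> 'u" where
  "const_lift U M L \<omega> c =
     compose (Mob M 1 (terminal U)) \<omega>
       (Mmap M 1 (terminal U) (Omega L) (\<lambda>_\<in>terminal U. const_sem L c))"

definition nullary_lift :: "('u, 'z) universe_scheme \<Rightarrow> ('t::monoid_mult, 'u) gmonad \<Rightarrow>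
    ('c, 'p, 'l, 't, 'u) logic \<Rightarrow> 'p \<Rightarrow> 'u \<Rightarrow> 'u" where
  "nullary_lift U M L p = (\<lambda>z\<in>Mob M 1 (terminal U). op_sem L p (tup U []))"

text \<open>Unique existence of the following map is a consequence of uniformity, for
  \<open>depth L l \<in> G\<close> and \<open>h\<close> an algebra homomorphism on \<open>Malg M t (terminal U)\<close>.\<close>

definition mod_lift :: "('u, 'z) universe_scheme \<Rightarrow> ('t::monoid_mult, 'u) gmonad \<Rightarrow>
    ('c, 'p, 'l, 't, 'u) logic \<Rightarrow> ('u \<Rightarrow> 'u) \<Rightarrow> 't \<Rightarrow> 'l \<Rightarrow> ('u \<Rightarrow> 'u) \<Rightarrow> 'u \<Rightarrow> 'u" where
  "mod_lift U M L \<omega> t l h =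
     (let g = depth L l; S = Mob M t (terminal U) in
      THE k. em_hom U M (Malg M (g * t) (terminal U)) (Omega L, \<omega>) k \<and>
             compose (Mob M g S) k (mu M g t (terminal U))
               = compose (Mob M g S) (mod_sem L l) (Mmap M g S (Omega L) h))"

definition unit_separating :: "('u, 'z) universe_scheme \<Rightarrow> ('t::monoid_mult, 'u) gmonad \<Rightarrow>
    ('c, 'p, 'l, 't, 'u) logic \<Rightarrow> ('u \<Rightarrow> 'u) \<Rightarrow> bool" where
  "unit_separating U M L \<omega> \<longleftrightarrow>
     jointly_injective (Mob M 1 (terminal U))
       ({const_lift U M L \<omega> c |c. c \<in> consts_of L} \<union>
        {nullary_lift U M L p |p. p \<in> ops_of L \<and> arity L p = 0})"

definition closed_under_ops :: "('u, 'z) universe_scheme \<Rightarrow> ('c, 'p, 'l, 't, 'u) logic \<Rightarrow> 'u set \<Rightarrow>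
    ('u \<Rightarrow> 'u) set \<Rightarrow> bool" where
  "closed_under_ops U L A \<AA> \<longleftrightarrow>
     (\<forall>p\<in>ops_of L. \<forall>hs. length hs = arity L p \<and> set hs \<subseteq> \<AA> \<longrightarrow>
        (\<lambda>z\<in>A. op_sem L p (tup U (map (\<lambda>h. h z) hs))) \<in> \<AA>)"

definition inductively_separating :: "('u, 'z) universe_scheme \<Rightarrow> ('t::monoid_mult, 'u) gmonad \<Rightarrow>
    't set \<Rightarrow> ('c, 'p, 'l, 't, 'u) logic \<Rightarrow> ('u \<Rightarrow> 'u) \<Rightarrow> bool" where
  "inductively_separating U M G L \<omega> \<longleftrightarrow>
     (\<forall>g\<in>G. \<forall>t. \<forall>\<AA>.
        (\<forall>h\<in>\<AA>. em_hom U M (Malg M t (terminal U)) (Omega L, \<omega>) h) \<and>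
        jointly_injective (Mob M t (terminal U)) \<AA> \<and>
        closed_under_ops U L (Mob M t (terminal U)) \<AA> \<longrightarrow>
        jointly_injective (Mob M (g * t) (terminal U))
          {mod_lift U M L \<omega> t l h |l h. l \<in> mods_of L \<and> depth L l = g \<and> h \<in> \<AA>})"

end

theory Submission
  imports Defs
begin

text \<open>
  Every formula \<open>\<phi>\<close> of uniform depth \<open>t\<close> is evaluated by an algebra homomorphism
  \<open>h : M\<^sub>t 1 \<rightarrow> \<Omega>\<close>, in the sense that \<open>\<phi>\<close> holds at \<open>x\<close> with value \<open>h (M\<^sub>t ! (\<gamma>\<^sub>t x))\<close>. The set of the
  homomorphisms that evaluate some formula is closed under the propositional operators, and
  \<open>h \<mapsto> mod_lift h\<close> maps the ones at \<open>t\<close> into the ones at \<open>g * t\<close>. Hence unit separation and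
  inductive separation show, by induction on a word in the generators, that this set is jointly
  injective at every \<open>t\<close>; that is, the formulae of depth \<open>t\<close> determine \<open>M\<^sub>t ! (\<gamma>\<^sub>t x)\<close>.
\<close>

section \<open>Extensional composition read at points\<close>

lemma compose_cong_point: "compose A g f = compose A g' f' \<Longrightarrow> x \<in> A \<Longrightarrow> g (f x) = g' (f' x)"
  by (metis compose_eq)

lemma compose_restrict_point:
  "compose A g f = (\<lambda>x\<in>A. u x) \<Longrightarrow> x \<in> A \<Longrightarrow> g (f x) = u x"
  by (metis compose_eq restrict_apply')

lemma compose_eqI: "(\<And>x. x \<in> A \<Longrightarrow> g (f x) = g' (f' x)) \<Longrightarrow> compose A g f = compose A g' f'"
  by (auto simp: compose_def fun_eq_iff)

lemma compose_PiE: "f \<in> A \<rightarrow>\<^sub>E B \<Longrightarrow> g \<in> B \<rightarrow>\<^sub>E C \<Longrightarrow> compose A g f \<in> A \<rightarrow>\<^sub>E C"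
  by (auto simp: compose_def PiE_iff)

lemma jointly_injective_mono:
  "jointly_injective A \<FF> \<Longrightarrow> \<FF> \<subseteq> \<GG> \<Longrightarrow> jointly_injective A \<GG>"
  unfolding jointly_injective_def by blast

section \<open>Graded monads on a universe of sets\<close>

locale graded_set_monad =
  fixes U :: "'u universe"
    and M :: "('t::monoid_mult, 'u) gmonad"
  assumes universe: "set_universe U"
    and monad: "graded_monad U M"
begin

abbreviation pt :: "'u set" where "pt \<equiv> terminal U"

lemma power_set_obj: "A \<in> objs U \<Longrightarrow> power_set U A n \<in> objs U"
  using universe by (simp add: set_universe_def)

lemma inj_tup: "inj (tup U)"
  using universe by (simp add: set_universe_def)

text \<open>Since \<open>objs U\<close> is nonempty and closed under finite powers, this places the
  terminal object in the universe.\<close>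

lemma terminal_eq_power_set: "pt = power_set U A 0"
  by (auto simp: terminal_def power_set_def)

lemma terminal_obj: "pt \<in> objs U"
proof -
  obtain A where "A \<in> objs U"
    using universe by (auto simp: set_universe_def)
  then show ?thesis
    using power_set_obj terminal_eq_power_set by metis
qed

lemma bang_in: "bang U X \<in> X \<rightarrow>\<^sub>E pt"
  by (auto simp: bang_def terminal_def)

lemma proj_in: "i < n \<Longrightarrow> proj U A n i \<in> power_set U A n \<rightarrow>\<^sub>E A"
  using inj_tup by (auto simp: proj_def power_set_def subset_iff)

lemma proj_tup:
  "length xs = n \<Longrightarrow> set xs \<subseteq> A \<Longrightarrow> proj U A n i (tup U xs) = xs ! i"
  using inj_tup by (auto simp: proj_def power_set_def)

lemma endofunctor: "set_endofunctor U (Mob M t) (Mmap M t)"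
  using monad by (simp add: graded_monad_def)

lemma Mob_obj: "A \<in> objs U \<Longrightarrow> Mob M t A \<in> objs U"
  using endofunctor by (simp add: set_endofunctor_def)

lemma Mmap_in:
  "A \<in> objs U \<Longrightarrow> B \<in> objs U \<Longrightarrow> f \<in> A \<rightarrow>\<^sub>E B \<Longrightarrow> Mmap M t A B f \<in> Mob M t A \<rightarrow>\<^sub>E Mob M t B"
  using endofunctor by (simp add: set_endofunctor_def)

lemma Mmap_mem:
  "A \<in> objs U \<Longrightarrow> B \<in> objs U \<Longrightarrow> f \<in> A \<rightarrow>\<^sub>E B \<Longrightarrow> z \<in> Mob M t A \<Longrightarrow> Mmap M t A B f z \<in> Mob M t B"
  using Mmap_in PiE_mem by metis

lemma Mmap_compose:
  assumes "A \<in> objs U" "B \<in> objs U" "C \<in> objs U" "f \<in> A \<rightarrow>\<^sub>E B" "g \<in> B \<rightarrow>\<^sub>E C" "z \<in> Mob M t A"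
  shows "Mmap M t A C (compose A g f) z = Mmap M t B C g (Mmap M t A B f z)"
proof -
  have "Mmap M t A C (compose A g f) = compose (Mob M t A) (Mmap M t B C g) (Mmap M t A B f)"
    using endofunctor[of t] assms unfolding set_endofunctor_def by blast
  with assms show ?thesis by (simp add: compose_eq)
qed

lemma mu_in: "A \<in> objs U \<Longrightarrow> mu M s t A \<in> Mob M s (Mob M t A) \<rightarrow>\<^sub>E Mob M (s * t) A"
  using monad by (simp add: graded_monad_def)

lemma mu_unit_in: "A \<in> objs U \<Longrightarrow> mu M 1 t A \<in> Mob M 1 (Mob M t A) \<rightarrow>\<^sub>E Mob M t A"
  using mu_in[of A 1 t] by simp

lemma eta_in: "A \<in> objs U \<Longrightarrow> eta M A \<in> A \<rightarrow>\<^sub>E Mob M 1 A"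
  using monad by (simp add: graded_monad_def)

lemma mu_natural:
  assumes "A \<in> objs U" "B \<in> objs U" "f \<in> A \<rightarrow>\<^sub>E B" "z \<in> Mob M s (Mob M t A)"
  shows "mu M s t B (Mmap M s (Mob M t A) (Mob M t B) (Mmap M t A B f) z)
    = Mmap M (s * t) A B f (mu M s t A z)"
proof -
  have "compose (Mob M s (Mob M t A)) (mu M s t B)
      (Mmap M s (Mob M t A) (Mob M t B) (Mmap M t A B f))
    = compose (Mob M s (Mob M t A)) (Mmap M (s * t) A B f) (mu M s t A)"
    using monad assms(1-3) unfolding graded_monad_def by meson
  then show ?thesis
    using assms(4) by (rule compose_cong_point)
qed

lemma eta_natural:
  assumes "A \<in> objs U" "B \<in> objs U" "f \<in> A \<rightarrow>\<^sub>E B" "z \<in> A"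
  shows "Mmap M 1 A B f (eta M A z) = eta M B (f z)"
proof -
  have "compose A (Mmap M 1 A B f) (eta M A) = compose A (eta M B) f"
    using monad assms unfolding graded_monad_def by metis
  then show ?thesis
    using assms(4) by (rule compose_cong_point)
qed

section \<open>Eilenberg-Moore algebras and their homomorphisms\<close>

lemma em_algebra_Malg:
  assumes "A \<in> objs U"
  shows "em_algebra U M (Malg M t A)"
proof -
  have unit: "compose (Mob M t A) (mu M 1 t A) (eta M (Mob M t A)) = (\<lambda>z\<in>Mob M t A. z)"
    using monad assms unfolding graded_monad_def by blast
  \<comment> \<open>The associativity law at \<open>r = s = 1\<close>; the grades
    \<open>1 * t\<close> and \<open>1 * 1\<close> are left unreduced to match its form and collapse
    afterwards.\<close>
  have "compose (Mob M 1 (Mob M 1 (Mob M t A)))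
          (mu M 1 (1 * t) A) (Mmap M 1 (Mob M 1 (Mob M t A)) (Mob M (1 * t) A) (mu M 1 t A))
        = compose (Mob M 1 (Mob M 1 (Mob M t A))) (mu M (1 * 1) t A) (mu M 1 1 (Mob M t A))"
    using monad assms unfolding graded_monad_def by blast
  with unit show ?thesis
    using assms by (simp add: Malg_def Mob_obj mu_unit_in)
qed

lemma fst_Malg: "fst (Malg M t A) = Mob M t A"
  by (simp add: Malg_def)

lemma em_hom_point:
  "em_hom U M (A, a) (B, b) f \<Longrightarrow> z \<in> Mob M 1 A \<Longrightarrow> f (a z) = b (Mmap M 1 A B f z)"
  by (auto dest: compose_cong_point)

lemma em_hom_compose:
  assumes f: "em_hom U M (A, a) (B, b) f" and g: "em_hom U M (B, b) (C, c) g"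
  shows "em_hom U M (A, a) (C, c) (compose A g f)"
proof -
  have objs: "A \<in> objs U" "B \<in> objs U" "C \<in> objs U"
    and funs: "f \<in> A \<rightarrow>\<^sub>E B" "g \<in> B \<rightarrow>\<^sub>E C" "a \<in> Mob M 1 A \<rightarrow>\<^sub>E A"
    using assms by auto
  have "compose A g f (a z) = c (Mmap M 1 A C (compose A g f) z)" if z: "z \<in> Mob M 1 A" for z
  proof -
    have "compose A g f (a z) = g (f (a z))"
      using PiE_mem[OF funs(3) z] by (simp add: compose_eq)
    also have "\<dots> = c (Mmap M 1 B C g (Mmap M 1 A B f z))"
      using em_hom_point[OF f z] em_hom_point[OF g] Mmap_mem[OF objs(1,2) funs(1) z] by simp
    finally show ?thesis
      using objs funs z by (simp add: Mmap_compose)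
  qed
  moreover have "compose A g f \<in> A \<rightarrow>\<^sub>E C"
    using funs compose_PiE by metis
  ultimately show ?thesis
    using assms by (auto intro: compose_eqI)
qed

text \<open>The structure of the power algebra is defined componentwise through the projections, so
  the homomorphism law of the tuple splits into the laws of its components. For the exponents that
  occur later, \<open>pow\<close> comes with the homomorphism property of the operators.\<close>

lemma em_hom_tuple:
  assumes alg: "em_algebra U M (A, a)"
    and pow: "em_algebra U M (power_alg U M (B, b) (length hs))"
    and homs: "\<And>h. h \<in> set hs \<Longrightarrow> em_hom U M (A, a) (B, b) h"
    and B: "B \<in> objs U"
  shows "em_hom U M (A, a) (power_alg U M (B, b) (length hs)) (\<lambda>z\<in>A. tup U (map (\<lambda>h. h z) hs))"
    (is "em_hom U M _ (power_alg U M _ ?n) ?\<tau>")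
proof -
  let ?P = "power_set U B ?n"
  have A: "A \<in> objs U" and a: "a \<in> Mob M 1 A \<rightarrow>\<^sub>E A"
    using alg by auto
  have h_mem: "h z \<in> B" if "h \<in> set hs" "z \<in> A" for h z
    using homs[OF that(1)] that(2) by (auto dest: PiE_mem)
  have \<tau>: "?\<tau> \<in> A \<rightarrow>\<^sub>E ?P"
    using h_mem by (auto simp: power_set_def intro!: imageI)
  \<comment> \<open>An equality of functions, off \<open>A\<close> as well, because it is later
    rewritten inside the argument of \<open>Mmap\<close>.\<close>
  have proj: "compose A (proj U B ?n i) ?\<tau> = hs ! i" if i: "i < ?n" for i
  proof
    fix z
    have h: "hs ! i \<in> A \<rightarrow>\<^sub>E B"
      using homs[of "hs ! i"] i by simp
    show "compose A (proj U B ?n i) ?\<tau> z = (hs ! i) z"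
    proof (cases "z \<in> A")
      case True
      have "proj U B ?n i (tup U (map (\<lambda>h. h z) hs)) = map (\<lambda>h. h z) hs ! i"
        using h_mem[OF _ True] by (intro proj_tup) (simp_all add: image_subset_iff)
      with True i show ?thesis
        by (simp add: compose_eq)
    next
      case False
      with PiE_arb[OF h False] show ?thesis
        by (simp add: compose_def)
    qed
  qed
  have "?\<tau> (a z) = snd (power_alg U M (B, b) ?n) (Mmap M 1 A ?P ?\<tau> z)" if z: "z \<in> Mob M 1 A" for z
  proof -
    have az: "a z \<in> A"
      using a z by (rule PiE_mem)
    have eq: "(hs ! i) (a z) = b (Mmap M 1 ?P B (proj U B ?n i) (Mmap M 1 A ?P ?\<tau> z))"
      if i: "i < ?n" for i
    proof -
      have "Mmap M 1 ?P B (proj U B ?n i) (Mmap M 1 A ?P ?\<tau> z) = Mmap M 1 A B (hs ! i) z"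
        using Mmap_compose[OF A power_set_obj[OF B] B \<tau> proj_in[OF i] z] proj[OF i] by simp
      then show ?thesis
        using em_hom_point[OF homs z] i by simp
    qed
    \<comment> \<open>\<open>power_alg\<close> lists its components by index, so the list
      \<open>hs\<close> is indexed in the same way.\<close>
    have "map (\<lambda>h. h (a z)) hs = map (\<lambda>i. (hs ! i) (a z)) [0..<?n]"
      by (rule nth_equalityI) simp_all
    also have "\<dots> = map (\<lambda>i. b (Mmap M 1 ?P B (proj U B ?n i) (Mmap M 1 A ?P ?\<tau> z))) [0..<?n]"
      by (intro map_cong refl eq) simp
    finally show ?thesis
      using az Mmap_mem[OF A power_set_obj[OF B] \<tau> z] by simp
  qed
  then have "compose (Mob M 1 A) ?\<tau> a
      = compose (Mob M 1 A) (snd (power_alg U M (B, b) ?n)) (Mmap M 1 A ?P ?\<tau>)"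
    by (rule compose_eqI)
  with alg pow \<tau> show ?thesis
    by simp
qed

section \<open>Graded coalgebras and their traces\<close>

lemma coalgebra_in: "graded_coalgebra U M X \<gamma> \<Longrightarrow> \<gamma> t \<in> X \<rightarrow>\<^sub>E Mob M t X"
  by (simp add: graded_coalgebra_def)

lemma coalgebra_obj: "graded_coalgebra U M X \<gamma> \<Longrightarrow> X \<in> objs U"
  by (simp add: graded_coalgebra_def)

lemma coalgebra_mult:
  assumes "graded_coalgebra U M X \<gamma>" "x \<in> X"
  shows "\<gamma> (s * t) x = mu M s t X (Mmap M s X (Mob M t X) (\<gamma> t) (\<gamma> s x))"
proof -
  have "\<gamma> (s * t) = compose X (mu M s t X) (compose X (Mmap M s X (Mob M t X) (\<gamma> t)) (\<gamma> s))"
    using assms unfolding graded_coalgebra_def by blast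
  with assms show ?thesis by (simp add: compose_eq)
qed

text \<open>For states of the carriers, trace equivalence is equality of these values at every
  grade. The trace is kept as a morphism on \<open>X\<close> so that the functors
  \<open>Mmap M s\<close> can be applied to it.\<close>

definition trace :: "'u set \<Rightarrow> ('t \<Rightarrow> 'u \<Rightarrow> 'u) \<Rightarrow> 't \<Rightarrow> 'u \<Rightarrow> 'u" where
  "trace X \<gamma> t = compose X (Mmap M t X pt (bang U X)) (\<gamma> t)"

lemma trace_in: "graded_coalgebra U M X \<gamma> \<Longrightarrow> trace X \<gamma> t \<in> X \<rightarrow>\<^sub>E Mob M t pt"
  unfolding trace_def
  by (intro compose_PiE[OF coalgebra_in] Mmap_in coalgebra_obj terminal_obj bang_in)

text \<open>Here \<open>\<gamma> 1\<close> is the unit, and its naturality carries the state to the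
  only point of \<open>pt\<close>; at grade 1 all states have the same trace.\<close>

lemma trace_one:
  assumes "graded_coalgebra U M X \<gamma>" "x \<in> X"
  shows "trace X \<gamma> 1 x = eta M pt (tup U [])"
proof -
  have "\<gamma> 1 = eta M X"
    using assms by (simp add: graded_coalgebra_def)
  with assms show ?thesis
    by (simp add: trace_def compose_eq eta_natural coalgebra_obj terminal_obj bang_in)
      (simp add: bang_def)
qed

text \<open>The coalgebra law produces \<open>mu\<close>, naturality of \<open>mu\<close> moves
  \<open>bang\<close> to the inner functor, and functoriality merges it there with
  \<open>\<gamma> t\<close>. This recursion matches the semantics of a modal operator.\<close>

lemma trace_mult:
  assumes co: "graded_coalgebra U M X \<gamma>" and x: "x \<in> X"
  shows "trace X \<gamma> (s * t) x = mu M s t pt (Mmap M s X (Mob M t pt) (trace X \<gamma> t) (\<gamma> s x))"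
proof -
  note X = coalgebra_obj[OF co] and \<gamma> = coalgebra_in[OF co] and b = bang_in[of X]
  have \<gamma>x: "\<gamma> s x \<in> Mob M s X"
    using \<gamma> x by (rule PiE_mem)
  then have "Mmap M s X (Mob M t X) (\<gamma> t) (\<gamma> s x) \<in> Mob M s (Mob M t X)"
    by (intro Mmap_mem X Mob_obj \<gamma>)
  then have "trace X \<gamma> (s * t) x = mu M s t pt (Mmap M s (Mob M t X) (Mob M t pt)
      (Mmap M t X pt (bang U X)) (Mmap M s X (Mob M t X) (\<gamma> t) (\<gamma> s x)))"
    using x by (simp add: trace_def compose_eq coalgebra_mult[OF co] mu_natural X terminal_obj b)
  then show ?thesis
    unfolding trace_def
    using Mmap_compose[OF X Mob_obj[OF X] Mob_obj[OF terminal_obj] \<gamma> Mmap_in[OF X terminal_obj b] \<gamma>x]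
    by simp
qed

end

section \<open>Trace logics and the lifting of modal operators\<close>

locale graded_trace_logic = graded_set_monad U M
  for U :: "'u universe"
    and M :: "('t::monoid_mult, 'u) gmonad" +
  fixes G :: "'t set"
    and L :: "('c, 'p, 'l, 't, 'u) logic"
    and \<omega> :: "'u \<Rightarrow> 'u"
  assumes uniform: "uniform_gmonad U M G"
    and logic: "graded_logic U M G L"
    and trace_logic: "trace_logic U M L \<omega>"
begin

abbreviation \<Omega> :: "'u set" where "\<Omega> \<equiv> Omega L"

lemma Omega_obj: "\<Omega> \<in> objs U"
  using logic by (simp add: graded_logic_def)

lemma Omega_alg: "em_algebra U M (\<Omega>, \<omega>)"
  using trace_logic by (simp add: trace_logic_def)

lemma omega_in: "\<omega> \<in> Mob M 1 \<Omega> \<rightarrow>\<^sub>E \<Omega>"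
  using Omega_alg by simp

lemma omega_eta: "w \<in> \<Omega> \<Longrightarrow> \<omega> (eta M \<Omega> w) = w"
  using Omega_alg by (auto dest: compose_restrict_point)

lemma mod_sem_in: "l \<in> mods_of L \<Longrightarrow> mod_sem L l \<in> Mob M (depth L l) \<Omega> \<rightarrow>\<^sub>E \<Omega>"
  using logic by (simp add: graded_logic_def)

lemma mod_sem_mu_right:
  assumes "l \<in> mods_of L" "z \<in> Mob M (depth L l) (Mob M 1 \<Omega>)"
  shows "mod_sem L l (mu M (depth L l) 1 \<Omega> z)
    = mod_sem L l (Mmap M (depth L l) (Mob M 1 \<Omega>) \<Omega> \<omega> z)"
  using trace_logic assms unfolding trace_logic_def Let_def by (blast dest: compose_cong_point)

lemma mod_sem_mu_left:
  assumes "l \<in> mods_of L" "z \<in> Mob M 1 (Mob M (depth L l) \<Omega>)"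
  shows "mod_sem L l (mu M 1 (depth L l) \<Omega> z)
    = \<omega> (Mmap M 1 (Mob M (depth L l) \<Omega>) \<Omega> (mod_sem L l) z)"
  using trace_logic assms unfolding trace_logic_def Let_def by (blast dest: compose_cong_point)

text \<open>The homomorphism law is the second equation that \<open>trace_logic\<close> demands of a
  modal operator.\<close>

lemma em_hom_mod_sem:
  assumes l: "l \<in> mods_of L"
  shows "em_hom U M (Malg M (depth L l) \<Omega>) (\<Omega>, \<omega>) (mod_sem L l)"
  using em_algebra_Malg[OF Omega_obj, of "depth L l"] Omega_alg mod_sem_in[OF l] mod_sem_mu_left[OF l]
  by (auto simp: Malg_def intro: compose_eqI)

lemma em_hom_Mmap:
  assumes "A \<in> objs U" "B \<in> objs U" "f \<in> A \<rightarrow>\<^sub>E B"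
  shows "em_hom U M (Malg M t A) (Malg M t B) (Mmap M t A B f)"
proof -
  have "compose (Mob M 1 (Mob M t A)) (Mmap M t A B f) (mu M 1 t A)
    = compose (Mob M 1 (Mob M t A)) (mu M 1 t B) (Mmap M 1 (Mob M t A) (Mob M t B) (Mmap M t A B f))"
    using mu_natural[OF assms, of _ 1 t] by (intro compose_eqI) simp
  then show ?thesis
    using em_algebra_Malg[OF assms(1), of t] em_algebra_Malg[OF assms(2), of t] Mmap_in[OF assms]
    by (simp add: Malg_def)
qed

text \<open>The composite of \<open>Mmap\<close> at \<open>h\<close> with \<open>mod_sem L l\<close>
  is a homomorphism that identifies the two legs of the pair in \<open>uniform_gmonad\<close>. It
  therefore factors uniquely through the coequalizer \<open>mu\<close>, which makes the description
  in \<open>mod_lift\<close> definite.\<close>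

lemma mod_lift:
  assumes l: "l \<in> mods_of L" and h: "em_hom U M (Malg M t pt) (\<Omega>, \<omega>) h"
  shows "em_hom U M (Malg M (depth L l * t) pt) (\<Omega>, \<omega>) (mod_lift U M L \<omega> t l h)" (is ?hom)
    and "z \<in> Mob M (depth L l) (Mob M t pt) \<Longrightarrow>
      mod_lift U M L \<omega> t l h (mu M (depth L l) t pt z)
        = mod_sem L l (Mmap M (depth L l) (Mob M t pt) \<Omega> h z)"
proof -
  let ?g = "depth L l" and ?S = "Mob M t pt"
  let ?k = "compose (Mob M ?g ?S) (mod_sem L l) (Mmap M ?g ?S \<Omega> h)"
  have g: "?g \<in> G"
    using l logic by (simp add: graded_logic_def)
  have S: "?S \<in> objs U" and S1: "Mob M 1 ?S \<in> objs U" and \<Omega>1: "Mob M 1 \<Omega> \<in> objs U"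
    by (simp_all add: Mob_obj terminal_obj Omega_obj)
  have h_in: "h \<in> ?S \<rightarrow>\<^sub>E \<Omega>"
    using h by (simp add: Malg_def)
  have h1: "Mmap M 1 ?S \<Omega> h \<in> Mob M 1 ?S \<rightarrow>\<^sub>E Mob M 1 \<Omega>"
    by (intro Mmap_in S Omega_obj h_in)
  have mu_in1: "mu M 1 t pt \<in> Mob M 1 ?S \<rightarrow>\<^sub>E ?S"
    by (intro mu_unit_in terminal_obj)
  have hom_k: "em_hom U M (Malg M ?g ?S) (\<Omega>, \<omega>) ?k"
    using em_hom_Mmap[OF S Omega_obj h_in, of ?g] em_hom_mod_sem[OF l]
    unfolding Malg_def by (rule em_hom_compose)
  \<comment> \<open>The homomorphism law of \<open>h\<close> as an equation of functions, to which
    the functor of grade \<open>?g\<close> is applied below.\<close>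
  have h_mu: "compose (Mob M 1 ?S) h (mu M 1 t pt) = compose (Mob M 1 ?S) \<omega> (Mmap M 1 ?S \<Omega> h)"
    using h by (simp add: Malg_def)
  have "?k (Mmap M ?g (Mob M 1 ?S) ?S (mu M 1 t pt) z) = ?k (mu M ?g 1 ?S z)"
    if z: "z \<in> Mob M ?g (Mob M 1 ?S)" for z
  proof -
    have mz: "mu M ?g 1 ?S z \<in> Mob M ?g ?S"
      using PiE_mem[OF mu_in[OF S, of ?g 1] z] by simp
    \<comment> \<open>From one leg to the other: the law of \<open>h\<close> introduces
      \<open>\<omega>\<close>, the first modal equation of \<open>trace_logic\<close> trades
      \<open>\<omega>\<close> for \<open>mu\<close>, and naturality of \<open>mu\<close> moves
      \<open>h\<close> past it.\<close>
    have "Mmap M ?g ?S \<Omega> h (Mmap M ?g (Mob M 1 ?S) ?S (mu M 1 t pt) z)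
      = Mmap M ?g (Mob M 1 \<Omega>) \<Omega> \<omega> (Mmap M ?g (Mob M 1 ?S) (Mob M 1 \<Omega>) (Mmap M 1 ?S \<Omega> h) z)"
      using Mmap_compose[OF S1 S Omega_obj mu_in1 h_in z]
        Mmap_compose[OF S1 \<Omega>1 Omega_obj h1 omega_in z] h_mu
      by simp
    moreover have "mod_sem L l \<dots> = mod_sem L l (mu M ?g 1 \<Omega>
        (Mmap M ?g (Mob M 1 ?S) (Mob M 1 \<Omega>) (Mmap M 1 ?S \<Omega> h) z))"
      using mod_sem_mu_right[OF l Mmap_mem[OF S1 \<Omega>1 h1 z]] by simp
    moreover have "\<dots> = mod_sem L l (Mmap M ?g ?S \<Omega> h (mu M ?g 1 ?S z))"
      using mu_natural[OF S Omega_obj h_in z] by simp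
    ultimately show ?thesis
      using mz Mmap_mem[OF S1 S mu_in1 z] by (simp add: compose_eq)
  qed
  then have "compose (Mob M ?g (Mob M 1 ?S)) ?k (Mmap M ?g (Mob M 1 ?S) ?S (mu M 1 t pt))
      = compose (Mob M ?g (Mob M 1 ?S)) ?k (mu M ?g 1 ?S)"
    by (rule compose_eqI)
  moreover have "em_coequalizer U M
          (Malg M ?g (Mob M 1 ?S)) (Malg M ?g ?S)
          (Mmap M ?g (Mob M 1 ?S) ?S (mu M 1 t pt)) (mu M ?g 1 ?S)
          (Malg M (?g * t) pt) (mu M ?g t pt)"
    using uniform g terminal_obj by (simp add: uniform_gmonad_def)
  ultimately have "\<exists>!u. em_hom U M (Malg M (?g * t) pt) (\<Omega>, \<omega>) u \<and>
      compose (Mob M ?g ?S) u (mu M ?g t pt) = ?k"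
    using hom_k unfolding em_coequalizer_def fst_Malg by blast
  then have *: "em_hom U M (Malg M (?g * t) pt) (\<Omega>, \<omega>) (mod_lift U M L \<omega> t l h) \<and>
      compose (Mob M ?g ?S) (mod_lift U M L \<omega> t l h) (mu M ?g t pt) = ?k"
    unfolding mod_lift_def Let_def by (rule theI')
  then show ?hom ..
  show "mod_lift U M L \<omega> t l h (mu M ?g t pt z) = mod_sem L l (Mmap M ?g ?S \<Omega> h z)"
    if "z \<in> Mob M ?g ?S"
    using * that by (blast dest: compose_cong_point)
qed

section \<open>Homomorphisms that evaluate formulae, uniformly in the coalgebra\<close>

definition evaluates :: "('c, 'p, 'l) formula \<Rightarrow> 't \<Rightarrow> ('u \<Rightarrow> 'u) \<Rightarrow> bool" where
  "evaluates \<phi> t h \<longleftrightarrow>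
     (\<forall>X \<gamma>. graded_coalgebra U M X \<gamma> \<longrightarrow> sem U M L X \<gamma> \<phi> = compose X h (trace X \<gamma> t))"

text \<open>Homomorphisms are what inductive separation accepts as its family. As
  \<open>evaluates\<close> ranges over all coalgebras, one member of this set serves two states of
  different coalgebras at once.\<close>

definition evaluators :: "'t \<Rightarrow> ('u \<Rightarrow> 'u) set" where
  "evaluators t = {h. em_hom U M (Malg M t pt) (\<Omega>, \<omega>) h \<and>
     (\<exists>\<phi>\<in>uniform_formulas L t. evaluates \<phi> t h)}"

text \<open>If each argument evaluates a formula, the combined map evaluates \<open>Op p\<close> of
  these formulae. It is a homomorphism as a tuple of homomorphisms followed by
  \<open>op_sem L p\<close>.\<close>

lemma closed_under_ops_evaluators: "closed_under_ops U L (Mob M t pt) (evaluators t)"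
  unfolding closed_under_ops_def
proof (intro ballI allI impI, elim conjE)
  fix p hs
  assume p: "p \<in> ops_of L" and len: "length hs = arity L p" and hs: "set hs \<subseteq> evaluators t"
  let ?S = "Mob M t pt"
  let ?h = "\<lambda>z\<in>?S. op_sem L p (tup U (map (\<lambda>h. h z) hs))"
  have "\<forall>h\<in>set hs. \<exists>\<phi>. \<phi> \<in> uniform_formulas L t \<and> evaluates \<phi> t h"
    using hs by (auto simp: evaluators_def)
  then obtain f where f: "\<And>h. h \<in> set hs \<Longrightarrow> f h \<in> uniform_formulas L t \<and> evaluates (f h) t h"
    by metis
  have op: "em_hom U M (power_alg U M (\<Omega>, \<omega>) (length hs)) (\<Omega>, \<omega>) (op_sem L p)"
    using trace_logic p len by (simp add: trace_logic_def)
  \<comment> \<open>The power is an algebra because it is the source of a homomorphism.\<close>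
  then have pow: "em_algebra U M (power_alg U M (\<Omega>, \<omega>) (length hs))"
    by simp
  have "em_hom U M (?S, mu M 1 t pt) (power_alg U M (\<Omega>, \<omega>) (length hs))
      (\<lambda>z\<in>?S. tup U (map (\<lambda>h. h z) hs))"
  proof (rule em_hom_tuple[OF _ pow _ Omega_obj])
    show "em_algebra U M (?S, mu M 1 t pt)"
      using em_algebra_Malg[OF terminal_obj] by (simp add: Malg_def)
    show "em_hom U M (?S, mu M 1 t pt) (\<Omega>, \<omega>) h" if "h \<in> set hs" for h
      using that hs by (auto simp: evaluators_def Malg_def)
  qed
  \<comment> \<open>Unfolding exposes the power algebra as a pair, the form in which homomorphisms
    compose.\<close>
  from this[unfolded power_alg.simps] op[unfolded power_alg.simps]
  have "em_hom U M (Malg M t pt) (\<Omega>, \<omega>) (compose ?S (op_sem L p) (\<lambda>z\<in>?S. tup U (map (\<lambda>h. h z) hs)))"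
    unfolding Malg_def by (rule em_hom_compose)
  moreover have "compose ?S (op_sem L p) (\<lambda>z\<in>?S. tup U (map (\<lambda>h. h z) hs)) = ?h"
    by (auto simp: compose_def)
  moreover have "Op p (map f hs) \<in> uniform_formulas L t"
    using p len f by (auto simp: uniform_formulas_def intro!: uniform_depth.op)
  moreover have "evaluates (Op p (map f hs)) t ?h"
    unfolding evaluates_def
  proof (intro allI impI)
    fix X \<gamma>
    assume co: "graded_coalgebra U M X \<gamma>"
    have "map (\<lambda>\<phi>. sem U M L X \<gamma> \<phi> x) (map f hs) = map (\<lambda>h. h (trace X \<gamma> t x)) hs" if "x \<in> X" for x
      using f co that by (simp add: evaluates_def compose_eq)
    then show "sem U M L X \<gamma> (Op p (map f hs)) = compose X ?h (trace X \<gamma> t)"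
      using PiE_mem[OF trace_in[OF co]] by (simp add: compose_def fun_eq_iff del: map_map map_eq_conv)
  qed
  ultimately show "?h \<in> evaluators t"
    by (auto simp: evaluators_def)
qed

text \<open>Closure under the operators, applied to the empty list of arguments.\<close>

lemma nullary_lift_evaluator:
  assumes "p \<in> ops_of L" "arity L p = 0"
  shows "nullary_lift U M L p \<in> evaluators 1"
proof -
  have "\<forall>hs. length hs = arity L p \<and> set hs \<subseteq> evaluators 1 \<longrightarrow>
      (\<lambda>z\<in>Mob M 1 pt. op_sem L p (tup U (map (\<lambda>h. h z) hs))) \<in> evaluators 1"
    using closed_under_ops_evaluators[of 1] assms(1) unfolding closed_under_ops_def by blast
  from this[rule_format, of "[]"] show ?thesis
    using assms by (simp add: nullary_lift_def)
qed

text \<open>The trace at grade 1 is the unit at the point; naturality carries it to the unit at the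
  value of \<open>c\<close>, and the unit law of \<open>\<omega>\<close> returns that value.\<close>

lemma const_lift_evaluator:
  assumes c: "c \<in> consts_of L"
  shows "const_lift U M L \<omega> c \<in> evaluators 1"
proof -
  let ?c = "\<lambda>_\<in>pt. const_sem L c"
  have c_mem: "const_sem L c \<in> \<Omega>"
    using logic c by (simp add: graded_logic_def)
  then have c_in: "?c \<in> pt \<rightarrow>\<^sub>E \<Omega>"
    by simp
  \<comment> \<open>A structure map is a homomorphism from the free algebra by its own associativity
    law.\<close>
  have "em_hom U M (Malg M 1 \<Omega>) (\<Omega>, \<omega>) \<omega>"
    using em_algebra_Malg[OF Omega_obj, of 1] Omega_alg by (simp add: Malg_def)
  with em_hom_Mmap[OF terminal_obj Omega_obj c_in, of 1]
  have "em_hom U M (Malg M 1 pt) (\<Omega>, \<omega>) (const_lift U M L \<omega> c)"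
    unfolding Malg_def const_lift_def by (rule em_hom_compose)
  moreover have "Const c \<in> uniform_formulas L 1"
    using c by (auto simp: uniform_formulas_def intro: uniform_depth.const)
  moreover have "evaluates (Const c) 1 (const_lift U M L \<omega> c)"
    unfolding evaluates_def
  proof (intro allI impI)
    fix X \<gamma>
    assume co: "graded_coalgebra U M X \<gamma>"
    have pt: "tup U [] \<in> pt"
      by (simp add: terminal_def)
    then have "const_lift U M L \<omega> c (trace X \<gamma> 1 x) = const_sem L c" if "x \<in> X" for x
      using that c_mem PiE_mem[OF eta_in[OF terminal_obj] pt]
        eta_natural[OF terminal_obj Omega_obj c_in pt]
      by (simp add: trace_one[OF co] const_lift_def compose_eq omega_eta)
    then show "sem U M L X \<gamma> (Const c) = compose X (const_lift U M L \<omega> c) (trace X \<gamma> 1)"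
      by (simp add: compose_def fun_eq_iff)
  qed
  ultimately show ?thesis
    by (auto simp: evaluators_def)
qed

text \<open>By \<open>trace_mult\<close> the trace at the product grade is a value of
  \<open>mu\<close>, where the lift acts as \<open>mod_sem L l\<close> after \<open>Mmap\<close> at
  \<open>h\<close>. Functoriality merges \<open>h\<close> with the trace at \<open>t\<close> into
  the semantics of the formula under the modality.\<close>

lemma mod_lift_evaluator:
  assumes l: "l \<in> mods_of L" and h: "h \<in> evaluators t"
  shows "mod_lift U M L \<omega> t l h \<in> evaluators (depth L l * t)"
proof -
  let ?g = "depth L l" and ?S = "Mob M t pt"
  have hom: "em_hom U M (Malg M t pt) (\<Omega>, \<omega>) h"
    using h by (simp add: evaluators_def)
  then have h_in: "h \<in> ?S \<rightarrow>\<^sub>E \<Omega>"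
    by (simp add: Malg_def)
  obtain \<phi> where \<phi>: "\<phi> \<in> uniform_formulas L t" "evaluates \<phi> t h"
    using h by (auto simp: evaluators_def)
  have "Modal l \<phi> \<in> uniform_formulas L (?g * t)"
    using l \<phi> by (auto simp: uniform_formulas_def intro: uniform_depth.modal)
  moreover have "evaluates (Modal l \<phi>) (?g * t) (mod_lift U M L \<omega> t l h)"
    unfolding evaluates_def
  proof (intro allI impI)
    fix X \<gamma>
    assume co: "graded_coalgebra U M X \<gamma>"
    note X = coalgebra_obj[OF co] and S = Mob_obj[OF terminal_obj, of t]
    have "mod_sem L l (Mmap M ?g X \<Omega> (sem U M L X \<gamma> \<phi>) (\<gamma> ?g x))
        = mod_lift U M L \<omega> t l h (trace X \<gamma> (?g * t) x)" if x: "x \<in> X" for x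
    proof -
      have \<gamma>x: "\<gamma> ?g x \<in> Mob M ?g X"
        using coalgebra_in[OF co] x by (rule PiE_mem)
      have "Mmap M ?g X \<Omega> (sem U M L X \<gamma> \<phi>) (\<gamma> ?g x)
          = Mmap M ?g ?S \<Omega> h (Mmap M ?g X ?S (trace X \<gamma> t) (\<gamma> ?g x))"
        using \<phi>(2) co Mmap_compose[OF X S Omega_obj trace_in[OF co] h_in \<gamma>x]
        by (simp add: evaluates_def)
      then show ?thesis
        using mod_lift(2)[OF l hom Mmap_mem[OF X S trace_in[OF co] \<gamma>x]] trace_mult[OF co x]
        by simp
    qed
    then show "sem U M L X \<gamma> (Modal l \<phi>)
        = compose X (mod_lift U M L \<omega> t l h) (trace X \<gamma> (?g * t))"
      by (simp add: compose_def fun_eq_iff)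
  qed
  ultimately show ?thesis
    using mod_lift(1)[OF l hom] by (auto simp: evaluators_def)
qed

text \<open>Inductive separation only passes from \<open>t\<close> to \<open>g * t\<close> for a
  generator \<open>g\<close>, hence the induction on words; the empty word is unit
  separation.\<close>

lemma jointly_injective_evaluators:
  assumes unit: "unit_separating U M L \<omega>"
    and ind: "inductively_separating U M G L \<omega>"
    and "set gs \<subseteq> G"
  shows "jointly_injective (Mob M (prod_list gs) pt) (evaluators (prod_list gs))"
  using assms(3)
proof (induction gs)
  case Nil
  have "jointly_injective (Mob M 1 pt) (evaluators 1)"
    using unit unfolding unit_separating_def
    \<comment> \<open>The separating lifts are all evaluators, and enlarging a family preserves
      joint injectivity.\<close>
    by (rule jointly_injective_mono) (auto intro: const_lift_evaluator nullary_lift_evaluator)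
  then show ?case
    by simp
next
  case (Cons g gs)
  let ?t = "prod_list gs"
  have "\<forall>h\<in>evaluators ?t. em_hom U M (Malg M ?t pt) (\<Omega>, \<omega>) h"
    by (simp add: evaluators_def)
  moreover have "jointly_injective (Mob M ?t pt) (evaluators ?t)" and "g \<in> G"
    using Cons by simp_all
  ultimately have "jointly_injective (Mob M (g * ?t) pt)
      {mod_lift U M L \<omega> ?t l h |l h. l \<in> mods_of L \<and> depth L l = g \<and> h \<in> evaluators ?t}"
    \<comment> \<open>The family supplied to inductive separation is the full set of evaluators at
      \<open>?t\<close>, whose closure under the operators is already known.\<close>
    using ind closed_under_ops_evaluators[of ?t] unfolding inductively_separating_def by blast
  then have "jointly_injective (Mob M (g * ?t) pt) (evaluators (g * ?t))"
    by (rule jointly_injective_mono) (auto intro: mod_lift_evaluator)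
  then show ?case
    by simp
qed

end

section \<open>Expressiveness with respect to trace equivalence\<close>

theorem theorem5p15:
  fixes U :: "'u universe"
    and M :: "('t::monoid_mult, 'u) gmonad"
    and G :: "'t set"
    and L :: "('c, 'p, 'l, 't, 'u) logic"
    and \<omega> :: "'u \<Rightarrow> 'u"
    and X Y :: "'u set"
    and \<gamma> \<delta> :: "'t \<Rightarrow> 'u \<Rightarrow> 'u"
    and x y :: 'u
  assumes "set_universe U"
    and "generating_set G"
    and "graded_monad U M"
    and "uniform_gmonad U M G"
    and "graded_logic U M G L"
    and "trace_logic U M L \<omega>"
    and "unit_separating U M L \<omega>"
    and "inductively_separating U M G L \<omega>"
    and "graded_coalgebra U M X \<gamma>"
    and "graded_coalgebra U M Y \<delta>"
    and "x \<in> X"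
    and "y \<in> Y"
    and "\<forall>k. \<forall>\<phi>\<in>uniform_formulas L k. sem U M L X \<gamma> \<phi> x = sem U M L Y \<delta> \<phi> y"
  shows "trace_equivalent U M X \<gamma> x Y \<delta> y"
proof -
  interpret graded_trace_logic U M G L \<omega>
    by unfold_locales fact+
  note coX = assms(9) and coY = assms(10)
  have "trace X \<gamma> t x = trace Y \<delta> t y" for t
  proof -
    obtain gs where gs: "set gs \<subseteq> G" "t = prod_list gs"
      using assms(2) unfolding generating_set_def by blast
    \<comment> \<open>The formula behind \<open>h\<close> has the same value at both states, and
      \<open>h\<close> computes it from the trace in either coalgebra.\<close>
    have "h (trace X \<gamma> t x) = h (trace Y \<delta> t y)" if h: "h \<in> evaluators t" for h
    proof -
      obtain \<phi> where \<phi>: "\<phi> \<in> uniform_formulas L t" "evaluates \<phi> t h"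
        using h by (auto simp: evaluators_def)
      have "h (trace X \<gamma> t x) = sem U M L X \<gamma> \<phi> x"
        using \<phi>(2) coX \<open>x \<in> X\<close> by (simp add: evaluates_def compose_eq)
      also have "\<dots> = sem U M L Y \<delta> \<phi> y"
        using assms(13) \<phi>(1) by blast
      also have "\<dots> = h (trace Y \<delta> t y)"
        using \<phi>(2) coY \<open>y \<in> Y\<close> by (simp add: evaluates_def compose_eq)
      finally show ?thesis .
    qed
    \<comment> \<open>No evaluator at \<open>t\<close> distinguishes the two traces, so joint
      injectivity identifies them.\<close>
    then show ?thesis
      using jointly_injective_evaluators[OF assms(7,8) gs(1)] gs(2)
        PiE_mem[OF trace_in[OF coX] \<open>x \<in> X\<close>] PiE_mem[OF trace_in[OF coY] \<open>y \<in> Y\<close>]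
      unfolding jointly_injective_def by blast
  qed
  then show ?thesis
    using \<open>x \<in> X\<close> \<open>y \<in> Y\<close> by (simp add: trace_equivalent_def trace_def compose_eq)
qed

end
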